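(* Let $q\in(0,1)$, $\alpha,\beta>-1$, $n\in\mathbb N$. For $j\in\mathbb N$ put $$\Phi_{j,n,q}^{\alpha,\beta}(x)=u_j\sum_{k=0}^nv_k\,b_{n,k,q}(q^{j+\beta+1})\,b_{n,k,q}(x),$$ where $u_j=(1-q)q^{j(\alpha+1)}(1-q^{j+1})_q^\beta$ for $j\in\mathbb N$, and $v_k^{-1}=q^{k(\beta+1)}\begin{bmatrix}n\\k\end{bmatrix}_qB_q(k+\alpha+1,n-k+\beta+1)$ for $k=0,\dots,n$. (i) For every $f:(0,1)\to\mathbb R$ satisfying condition $C(\alpha)$ and every $x\in[0,1]$, $$M_{n,q}^{\alpha,\beta}f(x)=\sum_{j=0}^\infty\Phi_{j,n,q}^{\alpha,\beta}(x)\,f(q^{j+\beta+1}).$$ (ii) For every $r\in\mathbb N$ the sequence $\Phi_{r,n,q}^{\alpha,\beta},\Phi_{r-1,n,q}^{\alpha,\beta},\dots,\Phi_{0,n,q}^{\alpha,\beta}$ is totally positive, i.e. for every finite family $0\le x_1<\dots<x_m\le1$ the collocation matrix $\big(\Phi_{r-j,n,q}^{\alpha,\beta}(x_i)\big)_{i=1,\dots,m;\,j=0,\dots,r}$ is totally positive (all its minors are non-negative).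
   Context: $\mathbb N$ includes $0$. For real $a$, $[a]_q=\frac{1-q^a}{1-q}$; $[n]_q!=\prod_{j=1}^n[j]_q$; $\begin{bmatrix}n\\k\end{bmatrix}_q=\frac{[n]_q!}{[k]_q!\,[n-k]_q!}$. For real $a$, $(1-x)_q^a=\prod_{j=0}^\infty\frac{1-q^jx}{1-q^{j+a}x}$. The Jackson integral is $\int_0^ah(t)\,d_qt=a(1-q)\sum_{i\ge0}q^ih(q^ia)$, and the $q$-Beta function is $B_q(u,v)=\int_0^1t^{u-1}(1-qt)_q^{v-1}\,d_qt$. Put $b_{n,k,q}(x)=\begin{bmatrix}n\\k\end{bmatrix}_qx^k(1-x)_q^{n-k}$, $0\le k\le n$. For $f:(0,1)\to\mathbb R$, $$M_{n,q}^{\alpha,\beta}f(x)=\sum_{k=0}^n f_{n,k,q}^{\alpha,\beta}\,b_{n,k,q}(x),\qquad f_{n,k,q}^{\alpha,\beta}=\frac{\int_0^1t^{k+\alpha}(1-qt)_q^{n-k+\beta}f(q^{\beta+1}t)\,d_qt}{\int_0^1t^{k+\alpha}(1-qt)_q^{n-k+\beta}\,d_qt}.$$ Condition $C(\alpha)$: there exist $\gamma\ge0$ with $\alpha>\gamma-1$ and $A\in(0,1]$ such that $x^\gamma f(x)$ is bounded on $(0,A]$ (for $A=1$, on $(0,1)$). Under this condition $M_{n,q}^{\alpha,\beta}f$ is well defined. *)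

theory Defs
  imports "HOL-Analysis.Infinite_Products" "Jordan_Normal_Form.Determinant"
    "Jordan_Normal_Form.DL_Submatrix"
begin

definition q_num :: "real \<Rightarrow> real \<Rightarrow> real" where
  "q_num q a = (1 - q powr a) / (1 - q)"

definition q_fact :: "real \<Rightarrow> nat \<Rightarrow> real" where
  "q_fact q n = (\<Prod>j=1..n. q_num q (real j))"

text \<open>Only meaningful for \<open>k \<le> n\<close> (natural-number subtraction).\<close>

definition q_binom :: "real \<Rightarrow> nat \<Rightarrow> nat \<Rightarrow> real" where
  "q_binom q n k = q_fact q n / (q_fact q k * q_fact q (n - k))"

text \<open>
  \<open>q_pow q x a\<close> is \<open>(1 - x)\<^sub>q\<^sup>a\<close>, the infinite product of
  \<open>(1 - q\<^sup>j x) / (1 - q\<^bsup>j+a\<^esup> x)\<close>.  For \<open>a = 0\<close> every factor cancels, so the value is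
  \<open>1\<close>; this is stated separately because at \<open>x = 1\<close> the factor for \<open>j = 0\<close> would be
  \<open>0 / 0\<close>, which is \<open>0\<close> in HOL.
\<close>

definition q_pow :: "real \<Rightarrow> real \<Rightarrow> real \<Rightarrow> real" where
  "q_pow q x a =
     (if a = 0 then 1
      else (\<Prod>j. (1 - q ^ j * x) / (1 - q powr (real j + a) * x)))"

definition jackson_integral :: "real \<Rightarrow> real \<Rightarrow> (real \<Rightarrow> real) \<Rightarrow> real" where
  "jackson_integral q a h = a * (1 - q) * (\<Sum>i. q ^ i * h (q ^ i * a))"

definition q_Beta :: "real \<Rightarrow> real \<Rightarrow> real \<Rightarrow> real" where
  "q_Beta q u v = jackson_integral q 1 (\<lambda>t. t powr (u - 1) * q_pow q (q * t) (v - 1))"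

definition q_bernstein :: "real \<Rightarrow> nat \<Rightarrow> nat \<Rightarrow> real \<Rightarrow> real" where
  "q_bernstein q n k x = q_binom q n k * x ^ k * q_pow q x (real (n - k))"

definition durrmeyer_coeff ::
  "real \<Rightarrow> real \<Rightarrow> real \<Rightarrow> nat \<Rightarrow> nat \<Rightarrow> (real \<Rightarrow> real) \<Rightarrow> real" where
  "durrmeyer_coeff q \<alpha> \<beta> n k f =
     jackson_integral q 1
       (\<lambda>t. t powr (real k + \<alpha>) * q_pow q (q * t) (real (n - k) + \<beta>) * f (q powr (\<beta> + 1) * t))
   / jackson_integral q 1
       (\<lambda>t. t powr (real k + \<alpha>) * q_pow q (q * t) (real (n - k) + \<beta>))"

text \<open>
  Functions on \<open>(0,1)\<close> are modelled as total functions; for \<open>0 < q < 1\<close> and \<open>\<beta> > -1\<close> the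
  Jackson integrals only evaluate \<open>f\<close> at the points \<open>q\<^bsup>i+\<beta>+1\<^esup>\<close>, which lie in \<open>(0,1)\<close>.
\<close>

definition durrmeyer ::
  "real \<Rightarrow> real \<Rightarrow> real \<Rightarrow> nat \<Rightarrow> (real \<Rightarrow> real) \<Rightarrow> real \<Rightarrow> real" where
  "durrmeyer q \<alpha> \<beta> n f x =
     (\<Sum>k=0..n. durrmeyer_coeff q \<alpha> \<beta> n k f * q_bernstein q n k x)"

text \<open>The intersection with \<open>(0,1)\<close> only matters for \<open>A = 1\<close>.\<close>

definition condition_C :: "real \<Rightarrow> (real \<Rightarrow> real) \<Rightarrow> bool" where
  "condition_C \<alpha> f \<longleftrightarrow>
     (\<exists>\<gamma> A. \<gamma> \<ge> 0 \<and> \<alpha> > \<gamma> - 1 \<and> A \<in> {0<..1} \<and>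
        bounded ((\<lambda>x. x powr \<gamma> * f x) ` ({0<..A} \<inter> {0<..<1})))"

definition durrmeyer_u :: "real \<Rightarrow> real \<Rightarrow> real \<Rightarrow> nat \<Rightarrow> real" where
  "durrmeyer_u q \<alpha> \<beta> j =
     (1 - q) * q powr (real j * (\<alpha> + 1)) * q_pow q (q ^ (j + 1)) \<beta>"

definition durrmeyer_v :: "real \<Rightarrow> real \<Rightarrow> real \<Rightarrow> nat \<Rightarrow> nat \<Rightarrow> real" where
  "durrmeyer_v q \<alpha> \<beta> n k =
     inverse (q powr (real k * (\<beta> + 1)) * q_binom q n k
              * q_Beta q (real k + \<alpha> + 1) (real (n - k) + \<beta> + 1))"

definition durrmeyer_Phi ::
  "real \<Rightarrow> real \<Rightarrow> real \<Rightarrow> nat \<Rightarrow> nat \<Rightarrow> real \<Rightarrow> real" where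
  "durrmeyer_Phi q \<alpha> \<beta> n j x =
     durrmeyer_u q \<alpha> \<beta> j *
     (\<Sum>k=0..n. durrmeyer_v q \<alpha> \<beta> n k
        * q_bernstein q n k (q powr (real j + \<beta> + 1)) * q_bernstein q n k x)"

definition totally_positive_mat :: "real mat \<Rightarrow> bool" where
  "totally_positive_mat M \<longleftrightarrow>
     (\<forall>I J. I \<subseteq> {..<dim_row M} \<and> J \<subseteq> {..<dim_col M} \<and> card I = card J
        \<longrightarrow> 0 \<le> Determinant.det (submatrix M I J))"

text \<open>
  Total positivity on \<open>S\<close> of the finite sequence \<open>\<phi> 0, \<dots>, \<phi> r\<close>: every collocation matrix at
  increasing nodes of \<open>S\<close> is totally positive.
\<close>

definition totally_positive_seq ::
  "real set \<Rightarrow> nat \<Rightarrow> (nat \<Rightarrow> real \<Rightarrow> real) \<Rightarrow> bool" where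
  "totally_positive_seq S r \<phi> \<longleftrightarrow>
     (\<forall>m x. strict_mono_on {..<m} x \<and> x ` {..<m} \<subseteq> S
        \<longrightarrow> totally_positive_mat (mat m (r + 1) (\<lambda>(i, j). \<phi> j (x i))))"

end

theory Submission
  imports Defs
begin

text \<open>
  The Jackson integrals in the operator evaluate \<open>f\<close> only at the nodes
  \<open>y\<^sub>j = q powr (j + \<beta> + 1)\<close>, so the operator is a series in the values \<open>f y\<^sub>j\<close>, and its
  coefficients can be computed.  Writing \<open>q_pow q x a\<close> as a quotient of values of the infinite product
  of the factors \<open>1 - q ^ j * x\<close> gives the cocycle identity
  \<open>q_pow q x (a + b) = q_pow q x a * q_pow q (q powr a * x) b\<close> (\<open>q_pow_add\<close>).  For \<open>a = \<beta>\<close> and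
  \<open>b = n - k\<close> it factors the weight of the \<open>k\<close>-th Jackson integral into a part depending on \<open>\<beta>\<close>
  alone and the \<open>q\<close>-Bernstein polynomial at \<open>y\<^sub>j\<close> (\<open>durrmeyer_kernel_summand\<close>).  The growth
  condition on \<open>f\<close> makes each series converge geometrically (\<open>condition_C_summable\<close>), and
  the finite sum over \<open>k\<close> may be taken inside.

  For total positivity, the collocation matrix of the kernel is a product of the form
  \<open>B(x) diag(v) B(y)\<^sup>T diag(u)\<close>, where \<open>B\<close> is the collocation matrix of the \<open>q\<close>-Bernstein basis,
  \<open>u\<close> and \<open>v\<close> are non-negative, and the nodes \<open>y\<close> are increasing because the sequence is taken in
  reverse order.  By the Cauchy-Binet formula, used here in a symmetrised form
  (\<open>cauchy_binet_symmetrised\<close>), a product of totally positive matrices is totally positive, so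
  it remains to treat \<open>B\<close>.

  The \<open>q\<close>-Bernstein basis is, up to positive factors, a system
  \<open>y ^ k * (\<Prod>j<n - k. 1 - c j * y)\<close> with \<open>c j \<le> 1\<close>.  All such systems are totally positive on
  the unit interval (\<open>gen_bernstein_totally_positive\<close>).  Eliminating with the smallest node from
  one chosen basis function to the next leaves, up to a positive factor, a non-negative
  combination of the basis functions of degree \<open>n - 1\<close> whose indices lie between the two.  A
  minor is thereby a non-negative combination of smaller minors of the system of degree
  \<open>n - 1\<close>, with interlacing and hence increasing indices, and induction applies.
\<close>

section \<open>Determinants of families indexed by initial segments\<close>

text \<open>
  Rows and columns are given by a plain function, so that a minor of a kernel is obtained by
  composing it with index maps.
\<close>

definition det_fun :: "nat \<Rightarrow> (nat \<Rightarrow> nat \<Rightarrow> real) \<Rightarrow> real" where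
  "det_fun p F = Determinant.det (mat p p (\<lambda>(a, b). F a b))"

lemma det_fun_0 [simp]: "det_fun 0 F = 1"
  by (simp add: det_fun_def Determinant.det_def)

lemma det_fun_cong:
  assumes "\<And>a b. a < p \<Longrightarrow> b < p \<Longrightarrow> F a b = G a b"
  shows "det_fun p F = det_fun p G"
  unfolding det_fun_def by (rule arg_cong[where f = Determinant.det], rule eq_matI) (auto simp: assms)

lemma det_fun_leibniz:
  "det_fun p F = (\<Sum>\<pi> | \<pi> permutes {..<p}. of_int (sign \<pi>) * (\<Prod>a<p. F a (\<pi> a)))"
proof -
  have "(\<Prod>i = 0..<p. mat p p (\<lambda>(a, b). F a b) $$ (i, \<pi> i)) = (\<Prod>a<p. F a (\<pi> a))"
    if "\<pi> permutes {..<p}" for \<pi>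
    unfolding atLeast0LessThan
    by (rule prod.cong) (use permutes_in_image[OF that] in auto)
  then show ?thesis
    by (simp add: det_fun_def Determinant.det_def atLeast0LessThan)
qed

lemma det_fun_transpose: "det_fun p (\<lambda>a b. F b a) = det_fun p F"
proof -
  have "mat p p (\<lambda>(a, b). F b a) = transpose_mat (mat p p (\<lambda>(a, b). F a b))"
    by (rule eq_matI) auto
  then show ?thesis
    unfolding det_fun_def by (simp add: Determinant.det_transpose[of _ p])
qed

lemma det_fun_scale:
  "det_fun p (\<lambda>a b. r a * c b * F a b) = (\<Prod>a<p. r a) * (\<Prod>b<p. c b) * det_fun p F"
proof -
  have "(\<Prod>a<p. r a * c (\<pi> a) * F a (\<pi> a))
      = (\<Prod>a<p. r a) * (\<Prod>b<p. c b) * (\<Prod>a<p. F a (\<pi> a))" if "\<pi> permutes {..<p}" for \<pi>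
    using prod.permute[OF that, of c] by (simp add: prod.distrib o_def)
  then show ?thesis
    by (simp add: det_fun_leibniz sum_distrib_left mult_ac)
qed

lemma det_fun_permute_rows:
  assumes "\<pi> permutes {..<p}"
  shows "det_fun p (\<lambda>a b. F (\<pi> a) b) = of_int (sign \<pi>) * det_fun p F"
proof -
  have "det_fun p (\<lambda>a b. F (\<pi> a) b)
      = Determinant.det (mat p p (\<lambda>(i, j). mat p p (\<lambda>(a, b). F a b) $$ (\<pi> i, j)))"
    unfolding det_fun_def
    by (rule arg_cong[where f = Determinant.det], rule eq_matI)
      (use permutes_in_image[OF assms] in auto)
  also have "\<dots> = of_int (sign \<pi>) * det_fun p F"
    unfolding det_fun_def
    by (rule Determinant.det_permute_rows) (use assms in \<open>auto simp: atLeast0LessThan\<close>)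
  finally show ?thesis .
qed

lemma det_fun_equal_rows:
  assumes "a < p" "a' < p" "a \<noteq> a'" "\<And>b. F a b = F a' b"
  shows "det_fun p F = 0"
  unfolding det_fun_def
  by (rule Determinant.det_identical_rows[of _ p a a']) (use assms in \<open>auto intro!: eq_vecI\<close>)

text \<open>
  The determinant is linear in each row, so a determinant whose rows are linear combinations
  of the rows \<open>H i\<close> expands over all choices \<open>f\<close> of one summand in every row.
\<close>

lemma det_fun_sum:
  assumes "finite S"
  shows "det_fun p (\<lambda>a b. \<Sum>i\<in>S. C a i * H i b)
       = (\<Sum>f\<in>{..<p} \<rightarrow>\<^sub>E S. (\<Prod>a<p. C a (f a)) * det_fun p (\<lambda>a. H (f a)))"
proof -
  have "det_fun p (\<lambda>a b. \<Sum>i\<in>S. C a i * H i b)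
      = (\<Sum>\<pi> | \<pi> permutes {..<p}. \<Sum>f\<in>{..<p} \<rightarrow>\<^sub>E S.
           of_int (sign \<pi>) * ((\<Prod>a<p. C a (f a)) * (\<Prod>a<p. H (f a) (\<pi> a))))"
    by (simp add: det_fun_leibniz prod_sum_PiE assms prod.distrib sum_distrib_left)
  also have "\<dots> = (\<Sum>f\<in>{..<p} \<rightarrow>\<^sub>E S. \<Sum>\<pi> | \<pi> permutes {..<p}.
           of_int (sign \<pi>) * ((\<Prod>a<p. C a (f a)) * (\<Prod>a<p. H (f a) (\<pi> a))))"
    by (rule sum.swap)
  finally show ?thesis
    by (simp add: det_fun_leibniz sum_distrib_left mult_ac)
qed

text \<open>
  One step of elimination: a multiple of each row is subtracted from the next one.  When this
  clears the first column below the corner, the determinant loses its first row and column.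
\<close>

lemma det_fun_eliminate:
  assumes F: "\<And>a b. a < p \<Longrightarrow> b \<le> p \<Longrightarrow> F (Suc a) b = R a * F a b + G a b"
    and G: "\<And>a. a < p \<Longrightarrow> G a 0 = 0"
  shows "det_fun (Suc p) F = F 0 0 * det_fun p (\<lambda>a b. G a (Suc b))"
proof -
  \<comment> \<open>Left multiplication by the unit lower bidiagonal matrix \<open>L\<close> performs the subtraction.\<close>
  define L where "L = mat (Suc p) (Suc p)
    (\<lambda>(i, j). (if j = i then 1 else 0) + (if Suc j = i then - R j else 0))"
  define M where "M = mat (Suc p) (Suc p) (\<lambda>(a, b). F a b)"
  define M' where "M' = mat (Suc p) (Suc p) (\<lambda>(a, b). case a of 0 \<Rightarrow> F 0 b | Suc a' \<Rightarrow> G a' b)"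
  have carrier: "L \<in> carrier_mat (Suc p) (Suc p)" "M \<in> carrier_mat (Suc p) (Suc p)"
    "M' \<in> carrier_mat (Suc p) (Suc p)"
    by (auto simp: L_def M_def M'_def)
  have "prod_list (diag_mat L) = prod_list (map (\<lambda>_. 1) [0..<Suc p])"
    unfolding diag_mat_def by (intro arg_cong[where f = prod_list] map_cong) (auto simp: L_def)
  also have "\<dots> = 1"
    by (induction p) simp_all
  finally have "Determinant.det L = 1"
    by (subst Determinant.det_lower_triangular[OF _ carrier(1)]) (auto simp: L_def)
  moreover have "L * M = M'"
  proof (rule eq_matI)
    fix i b assume "i < dim_row M'" "b < dim_col M'"
    then have i: "i \<le> p" and b: "b \<le> p"
      by (auto simp: M'_def)
    have "(L * M) $$ (i, b)
        = (\<Sum>j<Suc p. ((if j = i then 1 else 0) + (if Suc j = i then - R j else 0)) * F j b)"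
      using i b by (simp add: L_def M_def scalar_prod_def atLeast0LessThan del: sum.lessThan_Suc)
    also have "\<dots> = (\<Sum>j<Suc p. if j = i then F j b else 0)
                 + (\<Sum>j<Suc p. if Suc j = i then - R j * F j b else 0)"
      unfolding sum.distrib[symmetric] by (rule sum.cong) (auto simp: algebra_simps)
    also have "\<dots> = (case i of 0 \<Rightarrow> F 0 b | Suc a \<Rightarrow> G a b)"
    proof (cases i)
      case (Suc a)
      with i b F[of a b] show ?thesis
        by (simp add: sum.delta del: sum.lessThan_Suc)
    qed (simp add: sum.delta del: sum.lessThan_Suc)
    finally show "(L * M) $$ (i, b) = M' $$ (i, b)"
      using i b by (simp add: M'_def)
  qed (auto simp: L_def M_def M'_def)
  ultimately have "det_fun (Suc p) F = Determinant.det M'"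
    using Determinant.det_mult[OF carrier(1,2)] by (simp add: det_fun_def M_def)
  also have "\<dots> = (\<Sum>i<Suc p. M' $$ (i, 0) * cofactor M' i 0)"
    by (rule laplace_expansion_column[OF carrier(3)]) simp
  also have "\<dots> = F 0 0 * cofactor M' 0 0"
    unfolding sum.lessThan_Suc_shift by (simp add: M'_def G)
  also have "cofactor M' 0 0 = det_fun p (\<lambda>a b. G a (Suc b))"
    unfolding cofactor_def det_fun_def mat_delete_def
    by (simp, rule arg_cong[where f = Determinant.det], rule eq_matI) (auto simp: M'_def)
  finally show ?thesis .
qed

section \<open>Products of totally positive kernels\<close>

lemma sorting_permutation:
  fixes f :: "nat \<Rightarrow> 'a::linorder"
  assumes "inj_on f {..<p}"
  obtains \<pi> where "\<pi> permutes {..<p}" "strict_mono_on {..<p} (f \<circ> \<pi>)"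
proof -
  define xs where "xs = sorted_list_of_set (f ` {..<p})"
  have xs: "sorted_wrt (<) xs" "set xs = f ` {..<p}" "length xs = p" "distinct xs"
    using assms by (auto simp: xs_def card_image)
  define \<pi> where "\<pi> a = (if a < p then the_inv_into {..<p} f (xs ! a) else a)" for a
  have "bij_betw (\<lambda>a. xs ! a) {..<p} (f ` {..<p})"
    by (rule bij_betw_nth) (use xs in auto)
  moreover have "bij_betw (the_inv_into {..<p} f) (f ` {..<p}) {..<p}"
    using assms by (simp add: bij_betw_the_inv_into inj_on_imp_bij_betw)
  ultimately have "bij_betw (the_inv_into {..<p} f \<circ> (\<lambda>a. xs ! a)) {..<p} {..<p}"
    by (rule bij_betw_trans)
  then have "bij_betw \<pi> {..<p} {..<p}"
    by (rule bij_betw_cong[THEN iffD1, rotated]) (simp add: \<pi>_def)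
  then have perm: "\<pi> permutes {..<p}"
    by (rule bij_imp_permutes) (simp add: \<pi>_def)
  have "xs ! a \<in> f ` {..<p}" if "a < p" for a
    using nth_mem[of a xs] that unfolding xs(2,3) by simp
  then have "(f \<circ> \<pi>) a = xs ! a" if "a < p" for a
    using that f_the_inv_into_f[OF assms, of "xs ! a"] by (simp add: \<pi>_def)
  then have "strict_mono_on {..<p} (f \<circ> \<pi>)"
    using sorted_wrt_nth_less[OF xs(1)] xs(3) by (auto simp: strict_mono_on_def)
  with perm show ?thesis
    by (rule that)
qed

text \<open>
  The usual Cauchy-Binet formula sums over increasing index maps.  Summing over all maps \<open>f\<close>
  instead counts each increasing map \<open>p!\<close> times and adds zero terms for the non-injective
  ones.  This form has a short proof: the row expansion of the left-hand determinant is
  invariant under replacing \<open>f\<close> by \<open>f \<circ> \<pi>\<close>, and averaging over all permutations \<open>\<pi>\<close> turns the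
  product of the entries of \<open>A\<close> into a determinant.
\<close>

lemma cauchy_binet_symmetrised:
  assumes "finite S"
  shows "fact p * det_fun p (\<lambda>a b. \<Sum>i\<in>S. A a i * B i b)
       = (\<Sum>f\<in>{..<p} \<rightarrow>\<^sub>E S. det_fun p (\<lambda>a b. A a (f b)) * det_fun p (\<lambda>a. B (f a)))"
proof -
  let ?D = "det_fun p (\<lambda>a b. \<Sum>i\<in>S. A a i * B i b)"
  let ?P = "{\<pi>. \<pi> permutes {..<p}}"
  have D: "?D = (\<Sum>f\<in>{..<p} \<rightarrow>\<^sub>E S.
             of_int (sign \<pi>) * (\<Prod>a<p. A a (f (\<pi> a))) * det_fun p (\<lambda>a. B (f a)))"
    if \<pi>: "\<pi> permutes {..<p}" for \<pi>
  proof -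
    have into: "f \<circ> \<rho> \<in> {..<p} \<rightarrow>\<^sub>E S" if "f \<in> {..<p} \<rightarrow>\<^sub>E S" "\<rho> permutes {..<p}" for f \<rho>
      using that permutes_in_image[OF that(2)] permutes_not_in[OF that(2)]
      by (fastforce simp: PiE_iff extensional_def)
    have "bij_betw (\<lambda>f. f \<circ> \<pi>) ({..<p} \<rightarrow>\<^sub>E S) ({..<p} \<rightarrow>\<^sub>E S)"
      by (rule bij_betw_byWitness[where f' = "\<lambda>f. f \<circ> Hilbert_Choice.inv \<pi>"])
        (use into \<pi> permutes_inv[OF \<pi>] permutes_inv_o[OF \<pi>] in \<open>auto simp: comp_assoc\<close>)
    then have "?D = (\<Sum>f\<in>{..<p} \<rightarrow>\<^sub>E S.
        (\<Prod>a<p. A a ((f \<circ> \<pi>) a)) * det_fun p (\<lambda>a. B ((f \<circ> \<pi>) a)))"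
      unfolding det_fun_sum[OF assms] by (rule sum.reindex_bij_betw[symmetric])
    then show ?thesis
      using det_fun_permute_rows[OF \<pi>, of "\<lambda>a. B (f a)" for f] by (simp add: mult_ac)
  qed
  have "fact p * ?D = (\<Sum>\<pi>\<in>?P. ?D)"
    by (simp add: card_permutations[of _ p])
  also have "\<dots> = (\<Sum>\<pi>\<in>?P. \<Sum>f\<in>{..<p} \<rightarrow>\<^sub>E S.
             of_int (sign \<pi>) * (\<Prod>a<p. A a (f (\<pi> a))) * det_fun p (\<lambda>a. B (f a)))"
    by (rule sum.cong[OF refl]) (use D in blast)
  also have "\<dots> = (\<Sum>f\<in>{..<p} \<rightarrow>\<^sub>E S. \<Sum>\<pi>\<in>?P.
             of_int (sign \<pi>) * (\<Prod>a<p. A a (f (\<pi> a))) * det_fun p (\<lambda>a. B (f a)))"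
    by (rule sum.swap)
  finally show ?thesis
    by (simp add: det_fun_leibniz[of p "\<lambda>a b. A a (f b)" for f] sum_distrib_right)
qed

text \<open>
  In the symmetrised Cauchy-Binet sum every term is non-negative: sorting an injective \<open>f\<close>
  multiplies both determinants by the same sign, and a non-injective \<open>f\<close> repeats a row.
\<close>

lemma det_fun_product_nonneg:
  fixes S :: "nat set"
  assumes "finite S"
    and A: "\<And>g. strict_mono_on {..<p} g \<Longrightarrow> g \<in> {..<p} \<rightarrow> S \<Longrightarrow> 0 \<le> det_fun p (\<lambda>a b. A a (g b))"
    and B: "\<And>g. strict_mono_on {..<p} g \<Longrightarrow> g \<in> {..<p} \<rightarrow> S \<Longrightarrow> 0 \<le> det_fun p (\<lambda>a. B (g a))"
  shows "0 \<le> det_fun p (\<lambda>a b. \<Sum>i\<in>S. A a i * B i b)"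
proof -
  have "0 \<le> det_fun p (\<lambda>a b. A a (f b)) * det_fun p (\<lambda>a. B (f a))"
    if f: "f \<in> {..<p} \<rightarrow>\<^sub>E S" for f
  proof (cases "inj_on f {..<p}")
    case True
    then obtain \<pi> where \<pi>: "\<pi> permutes {..<p}" and mono: "strict_mono_on {..<p} (f \<circ> \<pi>)"
      by (rule sorting_permutation)
    have range: "f \<circ> \<pi> \<in> {..<p} \<rightarrow> S"
      using f permutes_in_image[OF \<pi>] by (auto simp: PiE_iff)
    have detA: "det_fun p (\<lambda>a b. A a ((f \<circ> \<pi>) b))
        = of_int (sign \<pi>) * det_fun p (\<lambda>a b. A a (f b))"
      using det_fun_permute_rows[OF \<pi>, of "\<lambda>b a. A a (f b)"]
        det_fun_transpose[of p "\<lambda>b a. A a ((f \<circ> \<pi>) b)"] det_fun_transpose[of p "\<lambda>b a. A a (f b)"]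
      by simp
    have detB: "det_fun p (\<lambda>a. B ((f \<circ> \<pi>) a)) = of_int (sign \<pi>) * det_fun p (\<lambda>a. B (f a))"
      using det_fun_permute_rows[OF \<pi>, of "\<lambda>a. B (f a)"] by simp
    have "0 \<le> det_fun p (\<lambda>a b. A a ((f \<circ> \<pi>) b)) * det_fun p (\<lambda>a. B ((f \<circ> \<pi>) a))"
      by (intro mult_nonneg_nonneg A[OF mono range] B[OF mono range])
    then show ?thesis
      unfolding detA detB by (cases \<pi> rule: sign_cases) auto
  next
    case False
    then obtain a a' where "a < p" "a' < p" "a \<noteq> a'" "f a = f a'"
      by (auto simp: inj_on_def)
    then have "det_fun p (\<lambda>a. B (f a)) = 0"
      by (intro det_fun_equal_rows[of a p a']) auto
    then show ?thesis
      by simp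
  qed
  then have "0 \<le> fact p * det_fun p (\<lambda>a b. \<Sum>i\<in>S. A a i * B i b)"
    unfolding cauchy_binet_symmetrised[OF assms(1)] by (rule sum_nonneg)
  then show ?thesis
    using fact_gt_zero[of p, where ?'a = real] unfolding zero_le_mult_iff by linarith
qed

text \<open>
  A submatrix selects its rows and columns by the increasing enumerations of two index sets,
  so minors along increasing index maps are all that total positivity asks about.
\<close>

lemma totally_positive_matI:
  assumes "\<And>p s t. strict_mono_on {..<p} s \<Longrightarrow> s \<in> {..<p} \<rightarrow> {..<m}
      \<Longrightarrow> strict_mono_on {..<p} t \<Longrightarrow> t \<in> {..<p} \<rightarrow> {..<N} \<Longrightarrow> 0 \<le> det_fun p (\<lambda>a b. F (s a) (t b))"
  shows "totally_positive_mat (mat m N (\<lambda>(i, j). F i j))"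
  unfolding totally_positive_mat_def
proof (intro allI impI, elim conjE)
  fix I J
  assume "I \<subseteq> {..<dim_row (mat m N (\<lambda>(i, j). F i j))}" "J \<subseteq> {..<dim_col (mat m N (\<lambda>(i, j). F i j))}"
    and card: "card I = card J"
  then have IJ: "I \<subseteq> {..<m}" "J \<subseteq> {..<N}"
    by auto
  have pick: "strict_mono_on {..<card K} (pick K)" "pick K \<in> {..<card K} \<rightarrow> {..<M}"
    if "K \<subseteq> {..<M}" for K M
    using that pick_mono_le[of _ K] pick_in_set_le[of _ K] by (auto simp: strict_mono_on_def)
  have "{i. i < m \<and> i \<in> I} = I" "{j. j < N \<and> j \<in> J} = J"
    using IJ by auto
  then have "submatrix (mat m N (\<lambda>(i, j). F i j)) I J
      = mat (card I) (card I) (\<lambda>(a, b). F (pick I a) (pick J b))"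
    unfolding submatrix_def using pick(2)[OF IJ(1)] pick(2)[OF IJ(2)] card
    by (intro eq_matI) (auto simp: Pi_iff)
  then show "0 \<le> Determinant.det (submatrix (mat m N (\<lambda>(i, j). F i j)) I J)"
    using assms[OF pick[OF IJ(1)], of "pick J"] pick[OF IJ(2)] card by (simp add: det_fun_def)
qed

section \<open>Total positivity of generalised Bernstein bases\<close>

text \<open>
  The weights \<open>c j = 1\<close> give the Bernstein basis and \<open>c j = q ^ j\<close> the \<open>q\<close>-Bernstein
  basis, each without its binomial factors.
\<close>

definition gen_bernstein :: "(nat \<Rightarrow> real) \<Rightarrow> nat \<Rightarrow> nat \<Rightarrow> real \<Rightarrow> real" where
  "gen_bernstein c n k y = y ^ k * (\<Prod>j<n - k. 1 - c j * y)"

lemma gen_bernstein_nonneg: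
  assumes "\<And>j. c j \<le> 1" "0 \<le> y" "y \<le> 1"
  shows "0 \<le> gen_bernstein c n k y"
proof -
  have "c j * y \<le> 1" for j
    using mult_right_mono[OF assms(1)[of j] assms(2)] assms(3) by simp
  then show ?thesis
    using assms(2) by (auto simp: gen_bernstein_def intro!: mult_nonneg_nonneg prod_nonneg)
qed

text \<open>
  Neighbouring basis functions of degree \<open>n\<close> have the quotient \<open>y / (1 - c (n - Suc k) * y)\<close>.
  The difference of this quotient at \<open>y\<close> and at \<open>x\<close> contains the factor \<open>y - x\<close>, and its
  denominator removes one factor of the basis function.  Hence eliminating the value at the
  node \<open>x\<close> leaves a basis function of degree \<open>n - 1\<close>.
\<close>

lemma gen_bernstein_step:
  fixes c n k x
  defines "d \<equiv> 1 - c (n - Suc k) * x"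
  assumes "k < n" "d \<noteq> 0"
  shows "gen_bernstein c n (Suc k) y
       = x / d * gen_bernstein c n k y + (y - x) * (1 / d * gen_bernstein c (n - 1) k y)"
proof -
  define T where "T = y ^ k * (\<Prod>j<n - Suc k. 1 - c j * y)"
  define e where "e = 1 - c (n - Suc k) * y"
  have "n - k = Suc (n - Suc k)"
    using assms by simp
  then have gb: "gen_bernstein c n (Suc k) y = y * T"
    "gen_bernstein c n k y = T * e" "gen_bernstein c (n - 1) k y = T"
    by (simp_all add: gen_bernstein_def T_def e_def)
  have "y * d = x * e + (y - x)"
    by (simp add: d_def e_def algebra_simps)
  then have "y = (x * e + (y - x)) / d"
    using assms(3) by (simp add: eq_divide_eq)
  then have "y * T = (x * e + (y - x)) / d * T"
    by simp
  also have "\<dots> = x / d * (T * e) + (y - x) * (1 / d * T)"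
    by (simp add: add_divide_distrib diff_divide_distrib algebra_simps)
  finally show ?thesis
    unfolding gb .
qed

text \<open>
  Iterating the step from \<open>m\<close> up to \<open>l\<close> collects the remainders of all intermediate steps;
  each further step only multiplies the earlier ones by \<open>x / d \<ge> 0\<close>.  That the remainder
  involves only indices in \<open>{m..<l}\<close> is what makes the induction on minors work.
\<close>

lemma gen_bernstein_interlacing:
  assumes "0 \<le> x" "\<And>j. 0 < 1 - c j * x" "m \<le> l" "l \<le> n"
  shows "\<exists>R W. (\<forall>i. 0 \<le> W i) \<and> (\<forall>y. gen_bernstein c n l y
      = R * gen_bernstein c n m y + (y - x) * (\<Sum>i\<in>{m..<l}. W i * gen_bernstein c (n - 1) i y))"
  using assms(3,4)
proof (induction l rule: dec_induct)
  case base
  show ?case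
    by (intro exI[of _ 1] exI[of _ "\<lambda>_. 0"]) simp
next
  case (step l)
  then obtain R W where W: "\<And>i. 0 \<le> W i" and R: "\<And>y. gen_bernstein c n l y
      = R * gen_bernstein c n m y + (y - x) * (\<Sum>i\<in>{m..<l}. W i * gen_bernstein c (n - 1) i y)"
    by auto
  define d where "d = 1 - c (n - Suc l) * x"
  have d: "0 < d"
    using assms(2) by (simp add: d_def)
  define e where "e = x / d"
  define g where "g = 1 / d"
  have nonneg: "0 \<le> e" "0 \<le> g"
    using d assms(1) by (simp_all add: e_def g_def)
  define W' where "W' i = (if i = l then g else e * W i)" for i
  have "gen_bernstein c n (Suc l) y = e * R * gen_bernstein c n m y
      + (y - x) * (\<Sum>i\<in>{m..<Suc l}. W' i * gen_bernstein c (n - 1) i y)" for y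
  proof -
    have "(\<Sum>i\<in>{m..<Suc l}. W' i * gen_bernstein c (n - 1) i y)
        = e * (\<Sum>i\<in>{m..<l}. W i * gen_bernstein c (n - 1) i y) + g * gen_bernstein c (n - 1) l y"
      using step.hyps by (simp add: W'_def sum_distrib_left mult_ac)
    moreover have "gen_bernstein c n (Suc l) y
        = e * gen_bernstein c n l y + (y - x) * (g * gen_bernstein c (n - 1) l y)"
      unfolding e_def g_def d_def by (rule gen_bernstein_step) (use step.prems d d_def in auto)
    ultimately show ?thesis
      unfolding R[of y] by (simp add: algebra_simps)
  qed
  moreover have "\<forall>i. 0 \<le> W' i"
    using W nonneg by (simp add: W'_def)
  ultimately show ?case
    by blast
qed

text \<open>
  Induction on the size of the minor, with the degree dropping by one in each step.  Eliminating
  with the smallest node \<open>x 0\<close> turns the minor into a non-negative combination of minors of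
  degree \<open>n - 1\<close> at the nodes \<open>x 1, x 2, \<dots>\<close>, whose row indices satisfy
  \<open>f a \<in> {k a..<k (Suc a)}\<close>.  Such indices are again increasing, since the intervals
  follow one another without overlap.  This is the mechanism of the branching rule for Schur polynomials,
  the case \<open>c = 0\<close>.
\<close>

lemma gen_bernstein_totally_positive:
  assumes c: "\<And>j. c j \<le> 1"
    and "strict_mono_on {..<p} k" "k \<in> {..<p} \<rightarrow> {..n}"
    and "strict_mono_on {..<p} x" "x \<in> {..<p} \<rightarrow> {0..1}"
  shows "0 \<le> det_fun p (\<lambda>a b. gen_bernstein c n (k a) (x b))"
  using assms(2-)
proof (induction p arbitrary: n k x)
  case (Suc p)
  have k_less: "k a < k b" if "a < b" "b \<le> p" for a b
    using Suc.prems(1) that by (auto simp: strict_mono_on_def)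
  have x_less: "x a < x b" if "a < b" "b \<le> p" for a b
    using Suc.prems(3) that by (auto simp: strict_mono_on_def)
  have k_le: "k a \<le> n" if "a \<le> p" for a
    using Suc.prems(2) that by (auto simp: Pi_iff)
  have x_ge: "0 \<le> x a" and x_le: "x a \<le> 1" if "a \<le> p" for a
    using Suc.prems(4) that by (auto simp: Pi_iff)
  have "\<exists>R W. (\<forall>i. 0 \<le> W i) \<and> (\<forall>y. gen_bernstein c n (k (Suc a)) y
      = R * gen_bernstein c n (k a) y
        + (y - x 0) * (\<Sum>i\<in>{k a..<k (Suc a)}. W i * gen_bernstein c (n - 1) i y))" if "a < p" for a
  proof (rule gen_bernstein_interlacing)
    \<comment> \<open>A second node exists here, so \<open>x 0\<close> cannot be the endpoint \<open>1\<close>, where \<open>1 - c j * x 0\<close>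
      could vanish.\<close>
    have "x 0 < 1"
      using x_less[of 0 p] x_le[of p] that by simp
    then show "0 < 1 - c j * x 0" for j
      using mult_right_mono[OF c[of j] x_ge[of 0]] by simp
  qed (use that x_ge k_less[of a "Suc a"] k_le[of "Suc a"] in auto)
  then obtain R W where W: "\<And>a i. a < p \<Longrightarrow> 0 \<le> W a i"
    and RW: "\<And>a y. a < p \<Longrightarrow> gen_bernstein c n (k (Suc a)) y
      = R a * gen_bernstein c n (k a) y
        + (y - x 0) * (\<Sum>i\<in>{k a..<k (Suc a)}. W a i * gen_bernstein c (n - 1) i y)"
    by metis
  \<comment> \<open>Extending the coefficients by \<open>0\<close> lets all rows sum over the same index set.\<close>
  define W' where "W' a i = (if i \<in> {k a..<k (Suc a)} then W a i else 0)" for a i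
  have W': "(\<Sum>i\<in>{k a..<k (Suc a)}. W a i * gen_bernstein c (n - 1) i y)
      = (\<Sum>i<n. W' a i * gen_bernstein c (n - 1) i y)" if "a < p" for a y
    by (rule sum.mono_neutral_cong_left) (use that k_le[of "Suc a"] in \<open>auto simp: W'_def\<close>)
  have "det_fun (Suc p) (\<lambda>a b. gen_bernstein c n (k a) (x b)) = gen_bernstein c n (k 0) (x 0)
      * det_fun p (\<lambda>a b. (x (Suc b) - x 0)
          * (\<Sum>i\<in>{k a..<k (Suc a)}. W a i * gen_bernstein c (n - 1) i (x (Suc b))))"
    by (rule det_fun_eliminate) (use RW in auto)
  also have "det_fun p (\<lambda>a b. (x (Suc b) - x 0)
          * (\<Sum>i\<in>{k a..<k (Suc a)}. W a i * gen_bernstein c (n - 1) i (x (Suc b))))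
      = det_fun p (\<lambda>a b. 1 * (x (Suc b) - x 0)
          * (\<Sum>i<n. W' a i * gen_bernstein c (n - 1) i (x (Suc b))))"
    by (rule det_fun_cong) (use W' in simp)
  also have "\<dots> = (\<Prod>b<p. x (Suc b) - x 0) * (\<Sum>f\<in>{..<p} \<rightarrow>\<^sub>E {..<n}.
      (\<Prod>a<p. W' a (f a)) * det_fun p (\<lambda>a b. gen_bernstein c (n - 1) (f a) (x (Suc b))))"
    unfolding det_fun_scale by (subst det_fun_sum) auto
  finally have expansion: "det_fun (Suc p) (\<lambda>a b. gen_bernstein c n (k a) (x b)) = \<dots>
      * gen_bernstein c n (k 0) (x 0)"
    by simp
  have summand: "0 \<le> (\<Prod>a<p. W' a (f a)) * det_fun p (\<lambda>a b. gen_bernstein c (n - 1) (f a) (x (Suc b)))"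
    if f: "f \<in> {..<p} \<rightarrow>\<^sub>E {..<n}" for f
  proof (cases "\<forall>a<p. f a \<in> {k a..<k (Suc a)}")
    case True
    have "f a < f b" if "a < b" "b < p" for a b
    proof -
      have "f a < k (Suc a)" "k b \<le> f b"
        using True that by auto
      moreover have "k (Suc a) \<le> k b"
        using k_less[of "Suc a" b] that by (cases "Suc a = b") auto
      ultimately show ?thesis
        by simp
    qed
    then have "0 \<le> det_fun p (\<lambda>a b. gen_bernstein c (n - 1) (f a) (x (Suc b)))"
    proof (intro Suc.IH[of f "n - 1" "\<lambda>b. x (Suc b)"])
      show "f \<in> {..<p} \<rightarrow> {..n - 1}"
      proof
        fix a assume "a \<in> {..<p}"
        then have "f a < n"
          using PiE_mem[OF f] by simp
        then show "f a \<in> {..n - 1}"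
          by simp
      qed
    qed (use x_less x_ge x_le in \<open>auto simp: strict_mono_on_def\<close>)
    then show ?thesis
      by (auto intro!: mult_nonneg_nonneg prod_nonneg simp: W'_def W)
  next
    case False
    then have "(\<Prod>a<p. W' a (f a)) = 0"
      by (auto simp: W'_def)
    then show ?thesis
      by (simp only: mult_zero_left order_refl)
  qed
  have "0 \<le> (\<Sum>f\<in>{..<p} \<rightarrow>\<^sub>E {..<n}.
      (\<Prod>a<p. W' a (f a)) * det_fun p (\<lambda>a b. gen_bernstein c (n - 1) (f a) (x (Suc b))))"
    by (rule sum_nonneg) (rule summand)
  moreover have "0 \<le> (\<Prod>b<p. x (Suc b) - x 0)"
    by (intro prod_nonneg) (use x_less in \<open>auto simp: less_imp_le\<close>)
  moreover have "0 \<le> gen_bernstein c n (k 0) (x 0)"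
    by (intro gen_bernstein_nonneg c x_ge x_le) simp_all
  ultimately show ?case
    unfolding expansion by (intro mult_nonneg_nonneg)
qed simp

section \<open>The function \<open>q_pow\<close> as a quotient of infinite \<open>q\<close>-Pochhammer symbols\<close>

definition q_pochhammer_inf :: "real \<Rightarrow> real \<Rightarrow> real" where
  "q_pochhammer_inf q x = (\<Prod>j. 1 - q ^ j * x)"

context
  fixes q :: real
  assumes q: "0 < q" "q < 1"
begin

lemma q_pochhammer_inf_convergent: "convergent_prod (\<lambda>j. 1 - q ^ j * x)"
proof (intro abs_convergent_prod_imp_convergent_prod summable_imp_abs_convergent_prod)
  have "summable (\<lambda>j. q ^ j * \<bar>x\<bar>)"
    by (intro summable_mult2 summable_geometric) (use q in auto)
  then show "summable (\<lambda>j. norm (1 - q ^ j * x - 1))"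
    using q by (simp add: abs_mult)
qed

lemma q_power_mult_le: "q ^ j * x \<le> x" if "0 \<le> x"
  using mult_right_mono[OF power_le_one[of q j] that] q by simp

lemma q_pochhammer_inf_has_prod:
  "(\<lambda>j. 1 - q ^ j * x) has_prod q_pochhammer_inf q x"
  unfolding q_pochhammer_inf_def by (rule convergent_prod_has_prod[OF q_pochhammer_inf_convergent])

lemma q_pochhammer_inf_pos:
  assumes "0 \<le> x" "x < 1"
  shows "0 < q_pochhammer_inf q x"
  by (rule has_prod_pos[OF q_pochhammer_inf_has_prod])
    (use q_power_mult_le[OF assms(1)] assms in \<open>smt (verit)\<close>)

lemma q_pochhammer_inf_antimono:
  assumes "0 \<le> y" "y \<le> x" "x < 1"
  shows "q_pochhammer_inf q x \<le> q_pochhammer_inf q y"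
proof (rule has_prod_le[OF q_pochhammer_inf_has_prod q_pochhammer_inf_has_prod])
  show "0 \<le> 1 - q ^ j * x \<and> 1 - q ^ j * x \<le> 1 - q ^ j * y" for j
    using q_power_mult_le[of x j] mult_left_mono[OF assms(2), of "q ^ j"] assms q by simp
qed

lemma q_pochhammer_inf_0: "q_pochhammer_inf q 0 = 1"
  by (simp add: q_pochhammer_inf_def)

text \<open>
  The endpoint \<open>x = 1\<close> needs its own argument, because splitting off a factor of an infinite
  product requires that factor to be non-zero; there both sides vanish.
\<close>

lemma q_pochhammer_inf_rec:
  assumes "0 \<le> x" "x \<le> 1"
  shows "q_pochhammer_inf q x = (1 - x) * q_pochhammer_inf q (q * x)"
proof (cases "x = 1")
  case True
  then show ?thesis
    using has_prod_eq_0_iff[OF q_pochhammer_inf_has_prod[of x]] by (auto intro!: image_eqI[of _ _ 0])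
next
  case False
  then show ?thesis
    using prodinf_split_head[OF q_pochhammer_inf_convergent, of x]
    by (simp add: q_pochhammer_inf_def mult_ac)
qed

lemma q_pochhammer_inf_split:
  assumes "0 \<le> x" "x \<le> 1"
  shows "q_pochhammer_inf q x = (\<Prod>j<m. 1 - q ^ j * x) * q_pochhammer_inf q (q ^ m * x)"
proof (induction m)
  case (Suc m)
  have "q_pochhammer_inf q (q ^ m * x)
      = (1 - q ^ m * x) * q_pochhammer_inf q (q * (q ^ m * x))"
    by (rule q_pochhammer_inf_rec) (use assms q q_power_mult_le[of x m] in auto)
  with Suc show ?case
    by (simp add: mult_ac)
qed simp

text \<open>
  This is the source of all properties of \<open>q_pow\<close> below.  For \<open>a = 0\<close> the second assumption
  reads \<open>x < 1\<close>, so that the quotient is \<open>1\<close> in accordance with the definition.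
\<close>

lemma q_pow_eq_ratio:
  assumes "0 \<le> x" "q powr a * x < 1"
  shows "q_pow q x a = q_pochhammer_inf q x / q_pochhammer_inf q (q powr a * x)"
proof (cases "a = 0")
  case True
  then show ?thesis
    using q_pochhammer_inf_pos[of x] assms q by (simp add: q_pow_def)
next
  case False
  have "q_pochhammer_inf q x / q_pochhammer_inf q (q powr a * x)
      = (\<Prod>j. (1 - q ^ j * x) / (1 - q ^ j * (q powr a * x)))"
    unfolding q_pochhammer_inf_def by (intro prodinf_divide q_pochhammer_inf_convergent)
  then show ?thesis
    using False q by (simp add: q_pow_def powr_add powr_realpow mult_ac)
qed

lemma q_pow_of_nat:
  assumes "0 \<le> x" "x \<le> 1"
  shows "q_pow q x (real m) = (\<Prod>j<m. 1 - q ^ j * x)"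
proof (cases m)
  case 0
  then show ?thesis
    by (simp add: q_pow_def)
next
  case (Suc l)
  have "q ^ m * x \<le> q ^ m * 1"
    using assms(2) q by (intro mult_left_mono) auto
  also have "\<dots> < 1"
    using q Suc power_Suc_less_one[of q l] by simp
  finally have less: "q ^ m * x < 1" .
  have "0 \<le> q ^ m * x"
    using assms q by simp
  with less have "0 < q_pochhammer_inf q (q ^ m * x)"
    by (intro q_pochhammer_inf_pos)
  moreover have "q_pow q x (real m) = q_pochhammer_inf q x / q_pochhammer_inf q (q ^ m * x)"
    using q_pow_eq_ratio[of x "real m"] assms less q by (simp add: powr_realpow)
  ultimately show ?thesis
    using q_pochhammer_inf_split[OF assms, of m] by simp
qed

text \<open>
  With the quotient representation this cocycle identity is the cancellation of the common
  factor \<open>q_pochhammer_inf q (q powr a * x)\<close>.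
\<close>

lemma q_pow_add:
  assumes "0 \<le> x" "q powr a * x < 1" "q powr (a + b) * x < 1"
  shows "q_pow q x (a + b) = q_pow q x a * q_pow q (q powr a * x) b"
proof -
  have eq: "q powr b * (q powr a * x) = q powr (a + b) * x"
    by (simp add: powr_add mult_ac)
  have "q_pow q (q powr a * x) b
      = q_pochhammer_inf q (q powr a * x) / q_pochhammer_inf q (q powr (a + b) * x)"
    using q_pow_eq_ratio[of "q powr a * x" b] assms unfolding eq by simp
  moreover have "0 < q_pochhammer_inf q (q powr a * x)"
    using assms q by (intro q_pochhammer_inf_pos) auto
  ultimately show ?thesis
    using q_pow_eq_ratio[OF assms(1,2)] q_pow_eq_ratio[OF assms(1,3)] by simp
qed

lemma q_powr_less_1: "q powr a < 1" if "0 < a"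
  using powr_less_mono2[of a q 1] that q by simp

lemma q_powr_node:
  assumes "b > - 1"
  shows "q powr b * q ^ (i + 1) = q powr (real i + b + 1)" "q powr (real i + b + 1) < 1"
proof -
  have "q ^ (i + 1) = q powr (real i + 1)"
    using q powr_realpow[of q "i + 1"] by (simp add: add.commute)
  then show "q powr b * q ^ (i + 1) = q powr (real i + b + 1)"
    by (simp add: powr_add[symmetric] add_ac)
  show "q powr (real i + b + 1) < 1"
    by (rule q_powr_less_1) (use assms in simp)
qed

text \<open>
  The upper bound does not depend on \<open>i\<close>: as the infinite product is antitone and at most
  \<open>1\<close>, the quotient is largest when its numerator is replaced by \<open>1\<close> and its denominator is
  taken at the largest node \<open>i = 0\<close>.
\<close>

lemma q_pow_node_bounds:
  assumes "b > - 1"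
  shows "0 < q_pow q (q ^ (i + 1)) b"
    and "q_pow q (q ^ (i + 1)) b \<le> 1 / q_pochhammer_inf q (q powr (b + 1))"
proof -
  let ?z = "q powr (real i + b + 1)"
  have z: "0 \<le> ?z" "?z < 1" "?z \<le> q powr (b + 1)" "q powr (b + 1) < 1"
    using assms q q_powr_node[OF assms, of i] q_powr_node[OF assms, of 0]
    by (auto intro!: powr_mono' simp: add_ac)
  have x: "0 \<le> q ^ (i + 1)" "q ^ (i + 1) < 1"
    using q power_Suc_less_one[of q i] by auto
  have eq: "q_pow q (q ^ (i + 1)) b = q_pochhammer_inf q (q ^ (i + 1)) / q_pochhammer_inf q ?z"
    using q_pow_eq_ratio[of "q ^ (i + 1)" b] z x unfolding q_powr_node[OF assms] by simp
  have pos: "0 < q_pochhammer_inf q (q ^ (i + 1))" "0 < q_pochhammer_inf q ?z"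
    "0 < q_pochhammer_inf q (q powr (b + 1))"
    using z x by (auto intro!: q_pochhammer_inf_pos)
  show "0 < q_pow q (q ^ (i + 1)) b"
    unfolding eq using pos by simp
  have "q_pochhammer_inf q (q ^ (i + 1)) \<le> 1"
    using q_pochhammer_inf_antimono[of 0 "q ^ (i + 1)"] x q_pochhammer_inf_0 by simp
  then show "q_pow q (q ^ (i + 1)) b \<le> 1 / q_pochhammer_inf q (q powr (b + 1))"
    unfolding eq using pos z by (intro frac_le q_pochhammer_inf_antimono) auto
qed

section \<open>Total positivity of the \<open>q\<close>-Bernstein basis\<close>

lemma q_fact_pos: "0 < q_fact q n"
  unfolding q_fact_def
proof (rule prod_pos)
  fix j assume "j \<in> {1..n}"
  then have "q powr real j < 1"
    by (intro q_powr_less_1) simp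
  then show "0 < q_num q (real j)"
    using q by (simp add: q_num_def)
qed

lemma q_binom_pos: "0 < q_binom q n k"
  by (simp add: q_binom_def q_fact_pos)

lemma q_bernstein_eq_gen_bernstein:
  assumes "0 \<le> x" "x \<le> 1"
  shows "q_bernstein q n k x = q_binom q n k * gen_bernstein (\<lambda>j. q ^ j) n k x"
  using q_pow_of_nat[OF assms] by (simp add: q_bernstein_def gen_bernstein_def)

lemma q_bernstein_totally_positive:
  assumes w: "\<And>i. 0 \<le> w i"
    and k: "strict_mono_on {..<p} k" "k \<in> {..<p} \<rightarrow> {..n}"
    and x: "strict_mono_on {..<p} x" "x \<in> {..<p} \<rightarrow> {0..1}"
  shows "0 \<le> det_fun p (\<lambda>a b. w (k a) * q_bernstein q n (k a) (x b))"
proof -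
  have "det_fun p (\<lambda>a b. w (k a) * q_bernstein q n (k a) (x b))
      = det_fun p (\<lambda>a b. (w (k a) * q_binom q n (k a)) * 1 * gen_bernstein (\<lambda>j. q ^ j) n (k a) (x b))"
    by (rule det_fun_cong) (use x(2) in \<open>auto simp: q_bernstein_eq_gen_bernstein Pi_iff\<close>)
  also have "\<dots> \<ge> 0"
    unfolding det_fun_scale
    by (intro mult_nonneg_nonneg prod_nonneg gen_bernstein_totally_positive k x)
      (use w q q_binom_pos in \<open>auto simp: power_le_one less_imp_le\<close>)
  finally show ?thesis .
qed

section \<open>The Durrmeyer operator and its kernel\<close>

text \<open>
  Near \<open>0\<close> the function \<open>f\<close> is at most of order \<open>x powr (- \<gamma>)\<close> and the \<open>q_pow\<close> factors stay bounded,
  so the series is dominated by a geometric one with ratio \<open>q powr (a + 1 - \<gamma>)\<close>, which is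
  less than \<open>1\<close> because \<open>a \<ge> \<alpha> > \<gamma> - 1\<close>.
\<close>

lemma condition_C_summable:
  assumes f: "condition_C \<alpha> f" and "\<beta> > - 1" "a \<ge> \<alpha>" "b > - 1"
  shows "summable (\<lambda>i. q ^ i * ((q ^ i) powr a * q_pow q (q ^ (i + 1)) b * f (q powr (\<beta> + 1) * q ^ i)))"
proof -
  obtain \<gamma> A where \<gamma>: "\<gamma> \<ge> 0" "\<alpha> > \<gamma> - 1" and A: "0 < A"
    and "bounded ((\<lambda>x. x powr \<gamma> * f x) ` ({0<..A} \<inter> {0<..<1}))"
    using f unfolding condition_C_def by auto
  then obtain K where "\<forall>z \<in> (\<lambda>x. x powr \<gamma> * f x) ` ({0<..A} \<inter> {0<..<1}). norm z \<le> K"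
    unfolding bounded_iff by blast
  then have K: "\<bar>x powr \<gamma> * f x\<bar> \<le> K" if "0 < x" "x \<le> A" "x < 1" for x
    using that by auto
  define y where "y i = q powr (\<beta> + 1) * q ^ i" for i
  define C where "C = 1 / q_pochhammer_inf q (q powr (b + 1)) * (K * q powr ((\<beta> + 1) * - \<gamma>))"
  have bound_pos: "0 < q_pochhammer_inf q (q powr (b + 1))"
    using q_powr_less_1[of "b + 1"] assms(4) by (intro q_pochhammer_inf_pos) auto
  have y_pos: "0 < y i" for i
    using q by (simp add: y_def)
  have y_less: "y i < 1" for i
    using q q_powr_node[OF assms(2), of i] by (simp add: y_def powr_add powr_realpow mult_ac)
  have "y \<longlonglongrightarrow> q powr (\<beta> + 1) * 0"
    unfolding y_def by (intro tendsto_mult tendsto_const LIMSEQ_realpow_zero) (use q in auto)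
  then have "\<forall>\<^sub>F i in sequentially. y i < A"
    using A by (intro order_tendstoD(2)) auto
  then have "\<forall>\<^sub>F i in sequentially.
      norm (q ^ i * ((q ^ i) powr a * q_pow q (q ^ (i + 1)) b * f (y i)))
        \<le> C * (q powr (a + 1 - \<gamma>)) ^ i"
  proof eventually_elim
    case (elim i)
    have "y i powr \<gamma> * \<bar>f (y i)\<bar> \<le> K"
      using K[of "y i"] y_pos[of i] y_less[of i] elim by (simp add: abs_mult)
    then have f_le: "\<bar>f (y i)\<bar> \<le> K * y i powr (- \<gamma>)"
      using y_pos[of i] by (simp add: powr_minus field_simps)
    have qi: "q ^ i = q powr real i"
      using q by (simp add: powr_realpow)
    have y_powr: "y i powr (- \<gamma>) = q powr ((\<beta> + 1) * - \<gamma>) * q powr (real i * - \<gamma>)"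
      unfolding y_def qi using q by (simp add: powr_mult powr_powr)
    have P: "0 < q_pow q (q ^ (i + 1)) b"
      "q_pow q (q ^ (i + 1)) b \<le> 1 / q_pochhammer_inf q (q powr (b + 1))"
      by (rule q_pow_node_bounds[OF assms(4)])+
    have "norm (q ^ i * ((q ^ i) powr a * q_pow q (q ^ (i + 1)) b * f (y i)))
        = q powr (real i * (a + 1)) * (q_pow q (q ^ (i + 1)) b * \<bar>f (y i)\<bar>)"
      using P(1) q unfolding qi by (simp add: abs_mult powr_powr powr_add[symmetric] algebra_simps)
    also have "\<dots> \<le> q powr (real i * (a + 1))
        * (1 / q_pochhammer_inf q (q powr (b + 1)) * (K * y i powr (- \<gamma>)))"
      using P f_le bound_pos by (intro mult_left_mono mult_mono) auto
    also have "\<dots> = C * (q powr (real i * (a + 1)) * q powr (real i * - \<gamma>))"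
      by (simp add: C_def y_powr)
    also have "q powr (real i * (a + 1)) * q powr (real i * - \<gamma>) = (q powr (a + 1 - \<gamma>)) ^ i"
      using q by (simp add: powr_add[symmetric] powr_realpow[symmetric] powr_powr algebra_simps)
    finally show ?case .
  qed
  moreover have "summable (\<lambda>i. C * (q powr (a + 1 - \<gamma>)) ^ i)"
    using q_powr_less_1[of "a + 1 - \<gamma>"] \<gamma> assms(3) by (intro summable_mult summable_geometric) auto
  ultimately show ?thesis
    unfolding y_def by (rule summable_comparison_test_ev)
qed

lemma q_Beta_eq:
  "q_Beta q u v = (1 - q) * (\<Sum>i. q ^ i * ((q ^ i) powr (u - 1) * q_pow q (q ^ (i + 1)) (v - 1)))"
  by (simp add: q_Beta_def jackson_integral_def)

text \<open>
  The value of a divergent series is unspecified, so convergence is needed even for the sign;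
  it is the summability lemma for the constant function \<open>1\<close>.
\<close>

lemma q_Beta_nonneg:
  assumes "0 < u" "0 < v"
  shows "0 \<le> q_Beta q u v"
proof -
  have "condition_C (u - 1) (\<lambda>_. 1)"
    unfolding condition_C_def using assms
    by (intro exI[of _ 0] exI[of _ 1]) (auto simp: bounded_iff)
  then have "summable (\<lambda>i. q ^ i * ((q ^ i) powr (u - 1) * q_pow q (q ^ (i + 1)) (v - 1) * 1))"
    by (rule condition_C_summable[of _ _ 0]) (use assms in auto)
  then show ?thesis
    unfolding q_Beta_eq using q q_pow_node_bounds(1)[of "v - 1"] assms
    by (intro mult_nonneg_nonneg suminf_nonneg) (auto simp: less_imp_le)
qed

text \<open>
  This identity is the reason for the normalisations \<open>u\<close> and \<open>v\<close> and for evaluating \<open>f\<close> at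
  \<open>q powr (\<beta> + 1) * t\<close> in the operator: by the cocycle identity the Jackson weight at \<open>t = q ^ j\<close>
  splits off the weight with exponent \<open>\<beta>\<close>, and the remaining factor is a \<open>q\<close>-Bernstein
  polynomial at the shifted node \<open>q powr (j + \<beta> + 1)\<close>.
\<close>

lemma durrmeyer_kernel_summand:
  assumes "\<beta> > - 1"
  shows "durrmeyer_u q \<alpha> \<beta> j
      * (durrmeyer_v q \<alpha> \<beta> n k * q_bernstein q n k (q powr (real j + \<beta> + 1)))
    = (1 - q) * (q ^ j * ((q ^ j) powr (real k + \<alpha>) * q_pow q (q ^ (j + 1)) (real (n - k) + \<beta>)))
      / q_Beta q (real k + \<alpha> + 1) (real (n - k) + \<beta> + 1)"
proof -
  define y where "y = q powr (real j + \<beta> + 1)"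
  have less_1: "q powr \<beta> * q ^ (j + 1) < 1" "q powr (\<beta> + real (n - k)) * q ^ (j + 1) < 1"
    using q_powr_node[of \<beta> j] q_powr_node[of "\<beta> + real (n - k)" j] assms by simp_all
  have cocycle: "q_pow q (q ^ (j + 1)) (real (n - k) + \<beta>)
      = q_pow q (q ^ (j + 1)) \<beta> * q_pow q y (real (n - k))"
    using q_pow_add[of "q ^ (j + 1)" \<beta> "real (n - k)", OF _ less_1] q q_powr_node(1)[of \<beta> j] assms
    by (simp add: y_def add.commute)
  have "q powr (real j * (\<alpha> + 1)) * y ^ k
      = q powr (real j * (\<alpha> + 1) + real k * (real j + \<beta> + 1))"
  proof -
    have "y ^ k = y powr real k"
      using q by (simp add: y_def powr_realpow)
    also have "\<dots> = q powr (real k * (real j + \<beta> + 1))"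
      unfolding y_def powr_powr by (simp only: mult.commute)
    finally show ?thesis
      by (simp only: powr_add)
  qed
  also have "\<dots> = q powr (real k * (\<beta> + 1) + real j + real j * (real k + \<alpha>))"
    by (simp add: algebra_simps)
  also have "\<dots> = q powr (real k * (\<beta> + 1)) * (q ^ j * (q ^ j) powr (real k + \<alpha>))"
  proof -
    have qj: "q ^ j = q powr real j"
      using q by (simp add: powr_realpow)
    show ?thesis
      unfolding qj powr_powr by (simp only: powr_add distrib_left mult_ac)
  qed
  finally have powers: "q powr (real j * (\<alpha> + 1)) * y ^ k
      = q powr (real k * (\<beta> + 1)) * (q ^ j * (q ^ j) powr (real k + \<alpha>))" .
  let ?B = "q_Beta q (real k + \<alpha> + 1) (real (n - k) + \<beta> + 1)"
  let ?Q = "q_pow q (q ^ (j + 1)) \<beta> * q_pow q y (real (n - k))"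
  have "durrmeyer_u q \<alpha> \<beta> j * (durrmeyer_v q \<alpha> \<beta> n k * q_bernstein q n k y)
      = (1 - q) * (q powr (real j * (\<alpha> + 1)) * y ^ k) * ?Q
        * (q_binom q n k / (q powr (real k * (\<beta> + 1)) * q_binom q n k * ?B))"
    by (simp add: durrmeyer_u_def durrmeyer_v_def q_bernstein_def field_simps)
  also have "\<dots> = (1 - q) * (q ^ j * (q ^ j) powr (real k + \<alpha>)) * ?Q / ?B"
    unfolding powers using q_binom_pos[of n k] q by simp
  finally show ?thesis
    unfolding cocycle y_def by (simp add: mult_ac)
qed

text \<open>
  Only finitely many \<open>k\<close> occur, so the sums over \<open>j\<close> and \<open>k\<close> may be interchanged as soon as
  the series over \<open>j\<close> converges for each \<open>k\<close>.
\<close>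

lemma durrmeyer_kernel_sums:
  assumes "\<beta> > - 1" "condition_C \<alpha> f"
  shows "(\<lambda>j. durrmeyer_Phi q \<alpha> \<beta> n j x * f (q powr (real j + \<beta> + 1))) sums durrmeyer q \<alpha> \<beta> n f x"
proof -
  have y: "q powr (\<beta> + 1) * q ^ j = q powr (real j + \<beta> + 1)" for j
    using q by (simp add: powr_realpow[symmetric] powr_add mult_ac)
  have "(\<lambda>j. durrmeyer_u q \<alpha> \<beta> j
        * (durrmeyer_v q \<alpha> \<beta> n k * q_bernstein q n k (q powr (real j + \<beta> + 1)))
        * f (q powr (real j + \<beta> + 1)) * q_bernstein q n k x)
      sums (durrmeyer_coeff q \<alpha> \<beta> n k f * q_bernstein q n k x)" if "k \<in> {0..n}" for k
  proof -
    define t where "t j = q ^ j * ((q ^ j) powr (real k + \<alpha>)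
      * q_pow q (q ^ (j + 1)) (real (n - k) + \<beta>) * f (q powr (\<beta> + 1) * q ^ j))" for j
    let ?B = "q_Beta q (real k + \<alpha> + 1) (real (n - k) + \<beta> + 1)"
    have "summable t"
      unfolding t_def by (rule condition_C_summable[OF assms(2,1)]) (use assms(1) in auto)
    then have "(\<lambda>j. (1 - q) * t j / ?B * q_bernstein q n k x)
        sums ((1 - q) * suminf t / ?B * q_bernstein q n k x)"
      by (intro sums_mult2 sums_divide sums_mult summable_sums)
    moreover have "durrmeyer_coeff q \<alpha> \<beta> n k f = (1 - q) * suminf t / ?B"
      by (simp add: durrmeyer_coeff_def q_Beta_def jackson_integral_def t_def[abs_def])
    moreover have "(1 - q) * t j / ?B = durrmeyer_u q \<alpha> \<beta> j
        * (durrmeyer_v q \<alpha> \<beta> n k * q_bernstein q n k (q powr (real j + \<beta> + 1)))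
        * f (q powr (real j + \<beta> + 1))" for j
      using durrmeyer_kernel_summand[OF assms(1), of \<alpha> j n k] by (simp add: t_def y)
    ultimately show ?thesis
      by simp
  qed
  then have "(\<lambda>j. \<Sum>k\<in>{0..n}. durrmeyer_u q \<alpha> \<beta> j
        * (durrmeyer_v q \<alpha> \<beta> n k * q_bernstein q n k (q powr (real j + \<beta> + 1)))
        * f (q powr (real j + \<beta> + 1)) * q_bernstein q n k x)
      sums (\<Sum>k\<in>{0..n}. durrmeyer_coeff q \<alpha> \<beta> n k f * q_bernstein q n k x)"
    by (rule sums_sum)
  then show ?thesis
    by (simp add: durrmeyer_def durrmeyer_Phi_def sum_distrib_left sum_distrib_right mult_ac)
qed

text \<open>
  Up to the non-negative column factors \<open>u\<close>, the kernel is the product of the \<open>q\<close>-Bernstein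
  collocation matrices at \<open>x\<close> and, transposed, at the nodes \<open>y b\<close>, with the non-negative
  weights \<open>v\<close> in between.  Reversing the sequence, \<open>j\<close> to \<open>r - j\<close>, makes these nodes increasing.
\<close>

lemma durrmeyer_kernel_totally_positive:
  assumes "\<alpha> > - 1" "\<beta> > - 1"
  shows "totally_positive_seq {0..1} r (\<lambda>j. durrmeyer_Phi q \<alpha> \<beta> n (r - j))"
  unfolding totally_positive_seq_def
proof (intro allI impI, elim conjE, rule totally_positive_matI)
  fix m :: nat and x :: "nat \<Rightarrow> real" and p :: nat and s t :: "nat \<Rightarrow> nat"
  assume x: "strict_mono_on {..<m} x" "x ` {..<m} \<subseteq> {0..1}"
    and s: "strict_mono_on {..<p} s" "s \<in> {..<p} \<rightarrow> {..<m}"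
    and t: "strict_mono_on {..<p} t" "t \<in> {..<p} \<rightarrow> {..<r + 1}"
  define y where "y b = q powr (real (r - t b) + \<beta> + 1)" for b
  let ?b = "\<lambda>k. q_bernstein q n k" and ?v = "durrmeyer_v q \<alpha> \<beta> n"
  have xs: "strict_mono_on {..<p} (x \<circ> s)" "x \<circ> s \<in> {..<p} \<rightarrow> {0..1}"
    using x s by (auto simp: strict_mono_on_def Pi_iff image_subset_iff)
  have y: "strict_mono_on {..<p} y" "y \<in> {..<p} \<rightarrow> {0..1}"
  proof -
    show "strict_mono_on {..<p} y"
    proof (rule strict_mono_onI)
      fix a b assume "a \<in> {..<p}" "b \<in> {..<p}" "a < b"
      then have "t a < t b" "t b \<le> r"
        using t by (auto simp: strict_mono_on_def Pi_iff less_Suc_eq_le)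
      then have "r - t b < r - t a"
        by simp
      then show "y a < y b"
        unfolding y_def using q by (intro powr_less_mono') auto
    qed
    show "y \<in> {..<p} \<rightarrow> {0..1}"
      using q_powr_node(2)[OF assms(2)] by (auto simp: y_def less_imp_le)
  qed
  have v: "0 \<le> ?v k" for k
    unfolding durrmeyer_v_def inverse_nonnegative_iff_nonnegative
    by (intro mult_nonneg_nonneg q_Beta_nonneg) (use q_binom_pos assms in \<open>auto simp: less_imp_le\<close>)
  have u: "0 \<le> durrmeyer_u q \<alpha> \<beta> j" for j
    using q_pow_node_bounds(1)[OF assms(2), of j] q by (simp add: durrmeyer_u_def)
  have "det_fun p (\<lambda>a b. durrmeyer_Phi q \<alpha> \<beta> n (r - t b) (x (s a)))
      = det_fun p (\<lambda>a b. 1 * durrmeyer_u q \<alpha> \<beta> (r - t b)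
          * (\<Sum>k\<in>{..n}. ?b k ((x \<circ> s) a) * (?v k * ?b k (y b))))"
    by (rule det_fun_cong) (simp add: durrmeyer_Phi_def y_def atLeast0AtMost mult_ac)
  also have "\<dots> \<ge> 0"
    unfolding det_fun_scale
  proof (intro mult_nonneg_nonneg prod_nonneg det_fun_product_nonneg)
    fix g assume g: "strict_mono_on {..<p} g" "g \<in> {..<p} \<rightarrow> {..n}"
    show "0 \<le> det_fun p (\<lambda>a b. ?b (g b) ((x \<circ> s) a))"
      using q_bernstein_totally_positive[OF _ g xs, of "\<lambda>_. 1"]
        det_fun_transpose[of p "\<lambda>a b. ?b (g a) ((x \<circ> s) b)"] by simp
    show "0 \<le> det_fun p (\<lambda>a b. ?v (g a) * ?b (g a) (y b))"
      by (rule q_bernstein_totally_positive[OF v g y])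
  qed (use u in auto)
  finally show "0 \<le> det_fun p (\<lambda>a b. durrmeyer_Phi q \<alpha> \<beta> n (r - t b) (x (s a)))" .
qed

end

theorem theorem1:
  fixes q \<alpha> \<beta> :: real and n :: nat
  assumes "0 < q" "q < 1" "\<alpha> > -1" "\<beta> > -1"
  shows "(\<forall>f :: real \<Rightarrow> real. \<forall>x \<in> {0..1}. condition_C \<alpha> f \<longrightarrow>
            (\<lambda>j. durrmeyer_Phi q \<alpha> \<beta> n j x * f (q powr (real j + \<beta> + 1)))
              sums durrmeyer q \<alpha> \<beta> n f x)
       \<and> (\<forall>r :: nat. totally_positive_seq {0..1} r (\<lambda>j. durrmeyer_Phi q \<alpha> \<beta> n (r - j)))"
  using durrmeyer_kernel_sums[OF assms(1,2,4)]
    durrmeyer_kernel_totally_positive[OF assms] by blast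

end
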